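(* Let $n\ge 3f+1$. Fix a margin parameter $m$ (a non-negative integer, the minimum verdict margin $\textit{verdict\_margin}^{\min}$) and suppose the protocol publishes a $\textsc{verdict\_commit}$ object in round $r$ with candidate group $G_{v^\star}$ and $\textit{verdict\_margin}\ge m$. (1) (Sufficiency.) If $m>f$, then $v^\star$ is the strict honest-reference plurality: $h_{v^\star}>h_v$ for every verdict $v\ne v^\star$. Consequently $v^\star=\mathrm{majority}_{\mathcal{H}}(V)$, and the tie-break rule is never invoked in computing $\mathrm{majority}_{\mathcal{H}}(V)$. (2) (Tightness.) For every $m\le f$ the conclusion fails: there is a delivered view with $|G_{v^\star}|\ge 2f+1$, $\textit{verdict\_margin}=m$, and $\mathrm{majority}_{\mathcal{H}}(V)\ne v^\star$. For the shipped operating point $m=1$ with $f=2$, part (2) applies, so honest-reference validity (the committed verdict equals $\mathrm{majority}_{\mathcal{H}}(V)$) is an empirical rate and not a guarantee. The same statement holds verbatim for the semantic branch ($\textsc{semantic\_commit}$ outcomes) once that branch is gated at margin $m$, i.e. also requires $\textit{verdict\_margin}\ge m$; the shipped semantic branch is gated at no margin at all, so not even $m=1$ applies to it.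
   Context: There are $n$ agents $\mathcal{N}=\{1,\dots,n\}$; a set $\mathcal{B}\subseteq\mathcal{N}$ with $|\mathcal{B}|\le f$ is Byzantine and $\mathcal{H}=\mathcal{N}\setminus\mathcal{B}$ is honest. A delivered view $V(r)$ of round $r$ consists of an index set $I_r\subseteq\mathcal{N}$ with $|I_r|\ge n-f$ and, for each $i\in I_r$, a proposal with one verdict in $\{\textsc{support},\textsc{refute},\textsc{insufficient}\}$ and a unit-norm embedding. $G_v\subseteq I_r$ is the set of delivered agents with verdict $v$. The candidate verdict is $v^\star=\arg\max_v|G_v|$, with exact ties broken by the priority $\textsc{support}>\textsc{refute}>\textsc{insufficient}$, and $\textit{verdict\_margin}=|G_{v^\star}|-\max_{v\ne v^\star}|G_v|$. Write $h_v=|G_v\cap\mathcal{H}|$. The honest-reference verdict $\mathrm{majority}_{\mathcal{H}}(V)$ is the verdict maximising $h_v$ over the delivered view (a plurality, not necessarily a strict majority), ties broken by the same priority order. The protocol first tries the semantic branch: a $\textsc{semantic\_commit}$ commits the verdict $v^\star$ and is published only if there is a selected core $\widehat{C}\subseteq G_{v^\star}$ with $|\widehat{C}|\ge 2f+1$ all of whose members' embeddings lie within a fixed angular radius $\theta_\alpha$ of the embedding of some member. If the semantic branch fails, a $\textsc{verdict\_commit}$ committing the verdict $v^\star$ is published only if $|G_{v^\star}|\ge 2f+1$ and $\textit{verdict\_margin}\ge m$. Every commit carries a certificate of $2f+1$ distinct signers. The shipped protocol uses $m=1$ on the verdict branch and no margin condition on the semantic branch.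
   Formalization: Part (2) is proved for f > 0 and n ≥ 4f+2−m on both branches (n ≥ 9 at the shipped point m=1, f=2; n ≥ 4f+2 for the ungated semantic claim): for f = 0 or smaller n no view of margin exactly m as described exists. *)

theory Defs
  imports "HOL-Analysis.Analysis"
begin

datatype verdict = Support | Refute | Insufficient

lemma UNIV_verdict: "UNIV = {Support, Refute, Insufficient}"
  using verdict.exhaust by auto

instance verdict :: finite
  by standard (simp add: UNIV_verdict)

definition agents :: "nat \<Rightarrow> nat set" where
  "agents n = {1..n}"

definition byzantine :: "nat \<Rightarrow> nat \<Rightarrow> nat set \<Rightarrow> bool" where
  "byzantine n f B \<longleftrightarrow> B \<subseteq> agents n \<and> card B \<le> f"

definition honest :: "nat \<Rightarrow> nat set \<Rightarrow> nat set" where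
  "honest n B = agents n - B"

text \<open>
  A view of one round; the two proposal fields are relevant only on \<open>delivered V\<close>.
\<close>

record 'e view =
  delivered :: "nat set"
  verdict_of :: "nat \<Rightarrow> verdict"
  embedding :: "nat \<Rightarrow> 'e"

definition delivered_view :: "nat \<Rightarrow> nat \<Rightarrow> 'e::euclidean_space view \<Rightarrow> bool" where
  "delivered_view n f V \<longleftrightarrow>
     delivered V \<subseteq> agents n \<and> n - f \<le> card (delivered V) \<and>
     (\<forall>i\<in>delivered V. norm (embedding V i) = 1)"

definition verdict_group :: "'e view \<Rightarrow> verdict \<Rightarrow> nat set" where
  "verdict_group V v = {i \<in> delivered V. verdict_of V i = v}"

definition maximisers :: "(verdict \<Rightarrow> nat) \<Rightarrow> verdict set" where
  "maximisers c = {v. \<forall>w. c w \<le> c v}"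

text \<open>The maximising verdict; exact ties go to \<open>Support\<close>, then \<open>Refute\<close>, then \<open>Insufficient\<close>.\<close>

definition plurality :: "(verdict \<Rightarrow> nat) \<Rightarrow> verdict" where
  "plurality c =
     (if Support \<in> maximisers c then Support
      else if Refute \<in> maximisers c then Refute
      else Insufficient)"

definition tie_break_invoked :: "(verdict \<Rightarrow> nat) \<Rightarrow> bool" where
  "tie_break_invoked c \<longleftrightarrow> card (maximisers c) > 1"

definition candidate :: "'e view \<Rightarrow> verdict" where
  "candidate V = plurality (\<lambda>v. card (verdict_group V v))"

definition verdict_margin :: "'e view \<Rightarrow> int" where
  "verdict_margin V =
     int (card (verdict_group V (candidate V)))
     - int (Max ((\<lambda>v. card (verdict_group V v)) ` (UNIV - {candidate V})))"

definition honest_count :: "nat \<Rightarrow> nat set \<Rightarrow> 'e view \<Rightarrow> verdict \<Rightarrow> nat" where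
  "honest_count n B V v = card (verdict_group V v \<inter> honest n B)"

definition honest_majority :: "nat \<Rightarrow> nat set \<Rightarrow> 'e view \<Rightarrow> verdict" where
  "honest_majority n B V = plurality (honest_count n B V)"

text \<open>
  Embeddings are unit vectors, so \<open>arccos\<close> of their inner product is the angle between them.
\<close>

definition semantic_core :: "nat \<Rightarrow> real \<Rightarrow> 'e::euclidean_space view \<Rightarrow> nat set \<Rightarrow> bool" where
  "semantic_core f \<theta> V C \<longleftrightarrow>
     C \<subseteq> verdict_group V (candidate V) \<and> 2 * f + 1 \<le> card C \<and>
     (\<exists>c\<in>C. \<forall>i\<in>C. arccos (embedding V i \<bullet> embedding V c) \<le> \<theta>)"

text \<open>
  The rule by which a core is selected is left open: \<open>sel\<close> is the outcome of the selection
  step of the round (\<open>None\<close> if nothing was selected).  The margin gate of the semantic branch is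
  \<open>None\<close> if the branch has no margin condition.
\<close>

definition gate_passes :: "nat option \<Rightarrow> 'e view \<Rightarrow> bool" where
  "gate_passes g V \<longleftrightarrow> (\<forall>k. g = Some k \<longrightarrow> int k \<le> verdict_margin V)"

definition semantic_succeeds ::
    "nat \<Rightarrow> real \<Rightarrow> nat option \<Rightarrow> 'e::euclidean_space view \<Rightarrow> nat set option \<Rightarrow> bool" where
  "semantic_succeeds f \<theta> g V sel \<longleftrightarrow>
     (\<exists>C. sel = Some C \<and> semantic_core f \<theta> V C) \<and> gate_passes g V"

definition certificate :: "nat \<Rightarrow> nat \<Rightarrow> nat set \<Rightarrow> bool" where
  "certificate n f S \<longleftrightarrow> S \<subseteq> agents n \<and> card S = 2 * f + 1"

text \<open>A commit carries the committed verdict and the signers of its certificate.\<close>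

datatype commit =
    Semantic_Commit verdict "nat set"
  | Verdict_Commit verdict "nat set"

text \<open>
  \<open>publishes n f \<theta> g m V sel c\<close>: commit \<open>c\<close> may be published on view \<open>V\<close> by the protocol
  with margin gate \<open>g\<close> on the semantic branch and minimum margin \<open>m\<close> on the verdict branch.
  The shipped protocol has \<open>g = None\<close> and \<open>m = 1\<close>.
\<close>

fun publishes ::
    "nat \<Rightarrow> nat \<Rightarrow> real \<Rightarrow> nat option \<Rightarrow> nat \<Rightarrow> 'e::euclidean_space view \<Rightarrow> nat set option
      \<Rightarrow> commit \<Rightarrow> bool" where
  "publishes n f \<theta> g m V sel (Semantic_Commit v S) \<longleftrightarrow>
     v = candidate V \<and> certificate n f S \<and> semantic_succeeds f \<theta> g V sel"
| "publishes n f \<theta> g m V sel (Verdict_Commit v S) \<longleftrightarrow>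
     v = candidate V \<and> certificate n f S \<and> \<not> semantic_succeeds f \<theta> g V sel \<and>
     2 * f + 1 \<le> card (verdict_group V (candidate V)) \<and> int m \<le> verdict_margin V"

text \<open>
  The size condition \<open>4 * f + 2 \<le> n + m\<close> and \<open>0 < f\<close>, under which tightness is claimed, cannot be
  dropped: every view as described there satisfies them.
\<close>

lemma tightness_view_bounds:
  fixes V :: "'e::euclidean_space view"
  assumes B: "byzantine n f B" and V: "delivered_view n f V"
    and big: "2 * f + 1 \<le> card (verdict_group V (candidate V))"
    and margin: "verdict_margin V = int m"
    and ne: "honest_majority n B V \<noteq> candidate V"
  shows "4 * f + 2 \<le> n + m" and "0 < f"
proof -
  let ?c = "\<lambda>v. card (verdict_group V v)" and ?v = "candidate V"
  have del: "delivered V \<subseteq> {1..n}"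
    using V by (simp add: delivered_view_def agents_def)
  have "UNIV - {?v} \<noteq> {}"
    by (cases ?v) (auto simp: UNIV_verdict)
  then have "Max (?c ` (UNIV - {?v})) \<in> ?c ` (UNIV - {?v})"
    by (intro Max_in) auto
  then obtain w where w: "w \<noteq> ?v" "Max (?c ` (UNIV - {?v})) = ?c w"
    by auto
  have sub: "verdict_group V ?v \<union> verdict_group V w \<subseteq> {1..n}"
    using del by (auto simp: verdict_group_def)
  have "finite (verdict_group V ?v)" "finite (verdict_group V w)"
    using finite_subset[OF sub] by auto
  then have "?c ?v + ?c w = card (verdict_group V ?v \<union> verdict_group V w)"
    using w(1) by (intro card_Un_disjoint[symmetric]) (auto simp: verdict_group_def)
  also have "\<dots> \<le> n"
    using card_mono[OF _ sub] by simp
  finally show "4 * f + 2 \<le> n + m"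
    using big margin w(2) by (simp add: verdict_margin_def)
  show "0 < f"
  proof (rule ccontr)
    assume "\<not> 0 < f"
    moreover have "finite B"
      using B finite_subset by (auto simp: byzantine_def agents_def)
    ultimately have "B = {}"
      using B by (simp add: byzantine_def)
    then have "honest_count n B V = ?c"
      using del by (auto simp: fun_eq_iff honest_count_def honest_def agents_def verdict_group_def
          intro!: arg_cong[where f = card])
    then show False
      using ne by (simp add: honest_majority_def candidate_def)
  qed
qed

end

theory Submission
  imports Defs
begin

text \<open>
  Byzantine agents can account for at most \<open>f\<close> members of the candidate group, so a margin above \<open>f\<close>
  survives their removal.  Conversely, for \<open>m \<le> f\<close> let all \<open>n\<close> agents be delivered and split between
  \<open>Support\<close> and \<open>Refute\<close> with a difference of exactly \<open>m\<close> (an odd agent out is \<open>Insufficient\<close>), and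
  let \<open>f\<close> members of the larger group be Byzantine.  The honest counts then favour the smaller group or
  tie; a tie needs \<open>m = f > 0\<close>, where the larger group may be chosen to be the one of lower priority.
\<close>

section \<open>Margins above \<open>f\<close> and the honest plurality\<close>

lemma maximisers_eq_singleton:
  assumes "\<And>w. w \<noteq> v \<Longrightarrow> c w < c v"
  shows "maximisers c = {v}"
proof -
  have "x = v" if "\<forall>w. c w \<le> c x" for x
    using that assms[of x] by (metis leD)
  moreover have "c w \<le> c v" for w
    using assms[of w] by (cases "w = v") auto
  ultimately show ?thesis
    by (auto simp: maximisers_def)
qed

lemma plurality_eq_of_singleton:
  "maximisers c = {v} \<Longrightarrow> plurality c = v"
  by (cases v) (auto simp: plurality_def)

lemma finite_verdict_group:
  "delivered_view n f V \<Longrightarrow> finite (verdict_group V v)"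
  by (rule finite_subset[of _ "{1..n}"])
    (auto simp: delivered_view_def agents_def verdict_group_def)

lemma verdict_margin_le:
  assumes "w \<noteq> candidate V"
  shows "verdict_margin V
    \<le> int (card (verdict_group V (candidate V))) - int (card (verdict_group V w))"
proof -
  have "card (verdict_group V w)
      \<le> Max ((\<lambda>v. card (verdict_group V v)) ` (UNIV - {candidate V}))"
    using assms by (intro Max_ge) auto
  then show ?thesis
    by (simp add: verdict_margin_def)
qed

text \<open>Phrased through the margin alone, so that the verdict branch and the gated semantic
  branch can share it.\<close>

lemma honest_plurality_of_margin:
  fixes V :: "'e::euclidean_space view"
  assumes B: "byzantine n f B" and V: "delivered_view n f V"
    and margin: "int f < verdict_margin V"
  shows "(\<forall>w. w \<noteq> candidate V \<longrightarrow> honest_count n B V w < honest_count n B V (candidate V)) \<and>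
    candidate V = honest_majority n B V \<and> \<not> tie_break_invoked (honest_count n B V)"
proof -
  have finB: "finite B" and cardB: "card B \<le> f"
    using B finite_subset by (auto simp: byzantine_def agents_def)
  have honest_eq: "verdict_group V v \<inter> honest n B = verdict_group V v - B" for v
    using V by (auto simp: delivered_view_def verdict_group_def honest_def)
  \<comment> \<open>Truncated subtraction is harmless for the candidate: a margin above
    \<open>f\<close> forces its group to have more than \<open>f\<close> members.\<close>
  have lower: "card (verdict_group V v) - f \<le> honest_count n B V v" for v
    using diff_card_le_card_Diff[OF finB, of "verdict_group V v"] cardB
    unfolding honest_count_def honest_eq by linarith
  have upper: "honest_count n B V v \<le> card (verdict_group V v)" for v
    unfolding honest_count_def by (intro card_mono finite_verdict_group[OF V]) auto
  have strict: "honest_count n B V w < honest_count n B V (candidate V)"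
    if "w \<noteq> candidate V" for w
    using verdict_margin_le[OF that] margin lower[of "candidate V"] upper[of w] by linarith
  \<comment> \<open>A single maximiser both fixes the plurality and excludes a tie.\<close>
  have "maximisers (honest_count n B V) = {candidate V}"
    by (rule maximisers_eq_singleton) (rule strict)
  then show ?thesis
    using strict by (simp add: plurality_eq_of_singleton honest_majority_def tie_break_invoked_def)
qed

section \<open>The two-group view with margin \<open>m\<close>\<close>

text \<open>
  For \<open>m = 0\<close> the two large groups have equal size, and the tie-break makes \<open>Support\<close> the candidate.
\<close>

definition leading :: "nat \<Rightarrow> verdict" where
  "leading m = (if m = 0 then Support else Refute)"

definition trailing :: "nat \<Rightarrow> verdict" where
  "trailing m = (if m = 0 then Refute else Support)"

text \<open>With L = \<open>(n + m) div 2\<close>, the groups have sizes L, L - m and (n + m) mod 2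
  when \<open>m + 2 \<le> n\<close>. The leading group comes first in the numbering so that the
  Byzantine set \<open>{1..f}\<close> fits inside it. All agents share one unit vector, which makes
  the view usable for semantic commits too.\<close>

definition split_view :: "nat \<Rightarrow> nat \<Rightarrow> 'e::euclidean_space view" where
  "split_view n m =
     \<lparr>delivered = {1..n},
      verdict_of = (\<lambda>i. if i \<le> (n + m) div 2 then leading m
        else if i \<le> 2 * ((n + m) div 2) - m then trailing m else Insufficient),
      embedding = (\<lambda>_. SOME b. b \<in> Basis)\<rparr>"

lemma verdict_leading_trailing_cases:
  obtains "v = leading m" | "v = trailing m" | "v = Insufficient"
  by (cases v; cases "m = 0") (auto simp: leading_def trailing_def)

lemma leading_trailing_distinct [simp]:
  "leading m \<noteq> trailing m" "trailing m \<noteq> leading m"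
  "leading m \<noteq> Insufficient" "trailing m \<noteq> Insufficient"
  "Insufficient \<noteq> leading m" "Insufficient \<noteq> trailing m"
  by (auto simp: leading_def trailing_def)

lemma delivered_view_split_view: "delivered_view n f (split_view n m)"
  by (simp add: delivered_view_def split_view_def agents_def)

context
  fixes n m :: nat
  assumes mn: "m + 2 \<le> n"
begin

lemma verdict_group_split_view:
  "verdict_group (split_view n m :: 'a::euclidean_space view) (leading m) = {1..(n + m) div 2}"
  "verdict_group (split_view n m :: 'a::euclidean_space view) (trailing m)
    = {(n + m) div 2 <.. 2 * ((n + m) div 2) - m}"
  "verdict_group (split_view n m :: 'a::euclidean_space view) Insufficient = {2 * ((n + m) div 2) - m <.. n}"
  using mn by (auto simp: verdict_group_def split_view_def split: if_splits)

text \<open>The bound \<open>m + 2 \<le> n\<close> gives the trailing group at least one member,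
  enough to match the at most one \<open>Insufficient\<close> agent left by rounding.\<close>

lemma card_verdict_group_split_view:
  "card (verdict_group (split_view n m :: 'a::euclidean_space view) (leading m)) = (n + m) div 2"
  "card (verdict_group (split_view n m :: 'a::euclidean_space view) (trailing m)) = (n + m) div 2 - m"
  "card (verdict_group (split_view n m :: 'a::euclidean_space view) Insufficient) \<le> (n + m) div 2 - m"
  using mn by (auto simp: verdict_group_split_view)

lemma candidate_split_view: "candidate (split_view n m :: 'a::euclidean_space view) = leading m"
proof -
  let ?c = "\<lambda>v. card (verdict_group (split_view n m :: 'a view) v)"
  have le: "?c v \<le> ?c (leading m)" for v
    using card_verdict_group_split_view[where 'a = 'a]
    by (cases v m rule: verdict_leading_trailing_cases) auto
  have "?c (trailing m) < ?c (leading m)" if "m \<noteq> 0"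
    using that mn by (simp add: card_verdict_group_split_view)
  \<comment> \<open>For positive \<open>m\<close> the leader is \<open>Refute\<close>, which is
    selected only once \<open>Support\<close> is excluded.\<close>
  then have "Support \<notin> maximisers ?c" if "m \<noteq> 0"
    using that by (auto simp: maximisers_def leading_def trailing_def not_le)
  moreover have "leading m \<in> maximisers ?c"
    using le by (simp add: maximisers_def)
  ultimately show ?thesis
    by (auto simp: candidate_def plurality_def leading_def split: if_splits)
qed

lemma verdict_margin_split_view:
  "verdict_margin (split_view n m :: 'a::euclidean_space view) = int m"
proof -
  let ?c = "\<lambda>v. card (verdict_group (split_view n m :: 'a view) v)"
  have "Max (?c ` (UNIV - {leading m})) = ?c (trailing m)"
  proof (rule Max_eqI)
    fix y assume "y \<in> ?c ` (UNIV - {leading m})"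
    then obtain v where "y = ?c v" "v \<noteq> leading m"
      by auto
    then show "y \<le> ?c (trailing m)"
      using card_verdict_group_split_view[where 'a = 'a]
      by (cases v m rule: verdict_leading_trailing_cases) auto
  qed auto
  then show ?thesis
    using mn by (simp add: verdict_margin_def candidate_split_view card_verdict_group_split_view)
qed

lemma honest_majority_split_view_ne:
  assumes f: "0 < f" "m \<le> f" and big: "f \<le> (n + m) div 2"
  shows "honest_majority n {1..f} (split_view n m :: 'a::euclidean_space view) \<noteq> leading m"
proof -
  let ?h = "honest_count n {1..f} (split_view n m :: 'a view)"
  have "verdict_group (split_view n m :: 'a view) (leading m) \<inter> honest n {1..f}
      = {f <.. (n + m) div 2}"
    using mn by (auto simp: verdict_group_split_view honest_def agents_def)
  then have lead: "?h (leading m) = (n + m) div 2 - f"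
    by (simp add: honest_count_def)
  have "verdict_group (split_view n m :: 'a view) (trailing m) \<inter> honest n {1..f}
      = {(n + m) div 2 <.. 2 * ((n + m) div 2) - m}"
    using mn big by (auto simp: verdict_group_split_view honest_def agents_def)
  then have trail: "?h (trailing m) = (n + m) div 2 - m"
    by (simp add: honest_count_def)
  have le: "?h (leading m) \<le> ?h (trailing m)"
    using f unfolding lead trail by simp
  show ?thesis
  \<comment> \<open>If \<open>m = 0\<close> the leader \<open>Support\<close> would win a tie, so a
    strict deficit is needed, and \<open>0 < f\<close> supplies it. Otherwise the leader is
    \<open>Refute\<close>, and a tie already goes to \<open>Support\<close>.\<close>
  proof (cases "m = 0")
    case True
    then have "?h Support < ?h Refute"
      using lead trail f big by (simp add: leading_def trailing_def)
    then have "Support \<notin> maximisers ?h"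
      by (auto simp: maximisers_def not_le)
    with True show ?thesis
      by (simp add: honest_majority_def plurality_def leading_def)
  next
    case False
    then have "?h Refute \<le> ?h Support"
      using le by (simp add: leading_def trailing_def)
    then have "Refute \<in> maximisers ?h \<Longrightarrow> Support \<in> maximisers ?h"
      by (auto simp: maximisers_def intro: order_trans)
    with False show ?thesis
      by (auto simp: honest_majority_def plurality_def leading_def)
  qed
qed

end

section \<open>Commits published on the two-group view\<close>

lemma semantic_core_split_view:
  assumes "m + 2 \<le> n" "2 * f + 1 \<le> (n + m) div 2" "0 \<le> \<theta>"
  shows "semantic_core f \<theta> (split_view n m :: 'a::euclidean_space view)
    (verdict_group (split_view n m :: 'a view) (leading m))"
proof -
  let ?V = "split_view n m :: 'a view"
  have "embedding ?V i \<bullet> embedding ?V j = 1" for i j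
    by (simp add: split_view_def inner_Basis some_in_eq)
  \<comment> \<open>Agent 1 serves as centre: every angle is \<open>arccos 1\<close>, which is
    0.\<close>
  moreover have "1 \<in> verdict_group ?V (leading m)"
    using assms by (simp add: verdict_group_split_view)
  ultimately show ?thesis
    using assms
    by (auto simp: semantic_core_def candidate_split_view card_verdict_group_split_view)
qed

lemma certificate_initial:
  "2 * f + 1 \<le> n \<Longrightarrow> certificate n f {1..2 * f + 1}"
  by (auto simp: certificate_def agents_def)

lemma publishes_split_view_semantic:
  assumes "m + 2 \<le> n" "2 * f + 1 \<le> n" "2 * f + 1 \<le> (n + m) div 2" "0 \<le> \<theta>"
    and "gate_passes g (split_view n m :: 'e::euclidean_space view)"
  shows "\<exists>sel S. publishes n f \<theta> g k (split_view n m :: 'e view) sel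
    (Semantic_Commit (leading m) S)"
  using assms semantic_core_split_view[of m n f \<theta>] certificate_initial[of f n]
  by (auto simp: candidate_split_view semantic_succeeds_def)

text \<open>Selecting no core makes the semantic branch fail under every gate \<open>g\<close>,
  which opens the verdict branch.\<close>

lemma publishes_split_view_verdict:
  assumes "m + 2 \<le> n" "2 * f + 1 \<le> n" "2 * f + 1 \<le> (n + m) div 2"
  shows "publishes n f \<theta> g m (split_view n m :: 'e::euclidean_space view) None
    (Verdict_Commit (leading m) {1..2 * f + 1})"
  using assms certificate_initial[of f n]
  by (simp add: candidate_split_view card_verdict_group_split_view verdict_margin_split_view
      semantic_succeeds_def)

lemma byzantine_initial: "f \<le> n \<Longrightarrow> byzantine n f {1..f}"
  by (auto simp: byzantine_def agents_def)

theorem theorem5p3: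
  fixes n f m :: nat and \<theta> :: real
    and g :: "nat option"  \<comment> \<open>margin gate of the semantic branch, in the verdict-branch claims\<close>
    and k :: nat           \<comment> \<open>minimum margin of the verdict branch, in the semantic-branch claims\<close>
  assumes n: "3 * f + 1 \<le> n" and theta: "0 \<le> \<theta>"
  shows
    \<comment> \<open>verdict branch: sufficiency\<close>
    "(f < m \<longrightarrow>
       (\<forall>B (V :: 'e::euclidean_space view) sel v S.
          byzantine n f B \<and> delivered_view n f V \<and>
          publishes n f \<theta> g m V sel (Verdict_Commit v S) \<longrightarrow>
          (\<forall>w. w \<noteq> candidate V \<longrightarrow> honest_count n B V w < honest_count n B V (candidate V)) \<and>
          candidate V = honest_majority n B V \<and>
          \<not> tie_break_invoked (honest_count n B V))) \<and>
    \<comment> \<open>verdict branch: tightness\<close>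
     (0 < f \<and> m \<le> f \<and> 4 * f + 2 \<le> n + m \<longrightarrow>
       (\<exists>B (V :: 'e view).
          byzantine n f B \<and> delivered_view n f V \<and>
          2 * f + 1 \<le> card (verdict_group V (candidate V)) \<and> verdict_margin V = int m \<and>
          honest_majority n B V \<noteq> candidate V \<and>
          (\<exists>sel S. publishes n f \<theta> g m V sel (Verdict_Commit (candidate V) S)))) \<and>
    \<comment> \<open>shipped verdict branch: no guarantee of honest-reference validity\<close>
     (f = 2 \<and> 9 \<le> n \<longrightarrow>
       \<not> (\<forall>B (V :: 'e view) sel v S.
            byzantine n f B \<and> delivered_view n f V \<and>
            publishes n f \<theta> None 1 V sel (Verdict_Commit v S) \<longrightarrow>
            v = honest_majority n B V)) \<and>
    \<comment> \<open>semantic branch gated at \<open>m\<close>: sufficiency\<close>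
     (f < m \<longrightarrow>
       (\<forall>B (V :: 'e view) sel v S.
          byzantine n f B \<and> delivered_view n f V \<and>
          publishes n f \<theta> (Some m) k V sel (Semantic_Commit v S) \<longrightarrow>
          (\<forall>w. w \<noteq> candidate V \<longrightarrow> honest_count n B V w < honest_count n B V (candidate V)) \<and>
          candidate V = honest_majority n B V \<and>
          \<not> tie_break_invoked (honest_count n B V))) \<and>
    \<comment> \<open>semantic branch gated at \<open>m\<close>: tightness\<close>
     (0 < f \<and> m \<le> f \<and> 4 * f + 2 \<le> n + m \<longrightarrow>
       (\<exists>B (V :: 'e view).
          byzantine n f B \<and> delivered_view n f V \<and>
          2 * f + 1 \<le> card (verdict_group V (candidate V)) \<and> verdict_margin V = int m \<and>
          honest_majority n B V \<noteq> candidate V \<and>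
          (\<exists>sel S. publishes n f \<theta> (Some m) k V sel (Semantic_Commit (candidate V) S)))) \<and>
    \<comment> \<open>shipped semantic branch: not even margin 1 is guaranteed\<close>
     (4 * f + 2 \<le> n \<longrightarrow>
       \<not> (\<forall>(V :: 'e view) sel v S.
            delivered_view n f V \<and>
            publishes n f \<theta> None 1 V sel (Semantic_Commit v S) \<longrightarrow>
            1 \<le> verdict_margin V))"
proof (intro conjI impI)
  assume "f < m"
  then show "\<forall>B (V :: 'e view) sel v S.
      byzantine n f B \<and> delivered_view n f V \<and>
      publishes n f \<theta> g m V sel (Verdict_Commit v S) \<longrightarrow>
      (\<forall>w. w \<noteq> candidate V \<longrightarrow> honest_count n B V w < honest_count n B V (candidate V)) \<and>
      candidate V = honest_majority n B V \<and> \<not> tie_break_invoked (honest_count n B V)"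
    by (intro allI impI honest_plurality_of_margin) auto
next
  assume "f < m"
  then show "\<forall>B (V :: 'e view) sel v S.
      byzantine n f B \<and> delivered_view n f V \<and>
      publishes n f \<theta> (Some m) k V sel (Semantic_Commit v S) \<longrightarrow>
      (\<forall>w. w \<noteq> candidate V \<longrightarrow> honest_count n B V w < honest_count n B V (candidate V)) \<and>
      candidate V = honest_majority n B V \<and> \<not> tie_break_invoked (honest_count n B V)"
    by (intro allI impI honest_plurality_of_margin)
      (auto simp: semantic_succeeds_def gate_passes_def)
next
  assume A: "0 < f \<and> m \<le> f \<and> 4 * f + 2 \<le> n + m"
  let ?V = "split_view n m :: 'e view"
  \<comment> \<open>The last bound restates \<open>4 * f + 2 \<le> n + m\<close>; the first follows
    from \<open>3 * f + 1 \<le> n\<close> with \<open>m \<le> f\<close> and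
    \<open>0 < f\<close>.\<close>
  have bounds: "m + 2 \<le> n" "2 * f + 1 \<le> n" "2 * f + 1 \<le> (n + m) div 2"
    using A n by auto
  have view: "byzantine n f {1..f} \<and> delivered_view n f ?V \<and>
      2 * f + 1 \<le> card (verdict_group ?V (candidate ?V)) \<and> verdict_margin ?V = int m \<and>
      honest_majority n {1..f} ?V \<noteq> candidate ?V"
    using A bounds byzantine_initial[of f n]
      delivered_view_split_view[of n f m, where 'a = 'e]
      honest_majority_split_view_ne[of m n f, where 'a = 'e]
    by (simp add: candidate_split_view card_verdict_group_split_view verdict_margin_split_view)
  show "\<exists>B (V :: 'e view).
      byzantine n f B \<and> delivered_view n f V \<and>
      2 * f + 1 \<le> card (verdict_group V (candidate V)) \<and> verdict_margin V = int m \<and>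
      honest_majority n B V \<noteq> candidate V \<and>
      (\<exists>sel S. publishes n f \<theta> g m V sel (Verdict_Commit (candidate V) S))"
    using view publishes_split_view_verdict[OF bounds, where 'e = 'e]
      candidate_split_view[OF bounds(1), where 'a = 'e] by metis
  have "gate_passes (Some m) ?V"
    using bounds by (simp add: gate_passes_def verdict_margin_split_view)
  then show "\<exists>B (V :: 'e view).
      byzantine n f B \<and> delivered_view n f V \<and>
      2 * f + 1 \<le> card (verdict_group V (candidate V)) \<and> verdict_margin V = int m \<and>
      honest_majority n B V \<noteq> candidate V \<and>
      (\<exists>sel S. publishes n f \<theta> (Some m) k V sel (Semantic_Commit (candidate V) S))"
    using view publishes_split_view_semantic[OF bounds theta]
      candidate_split_view[OF bounds(1), where 'a = 'e] by metis
next
  assume A: "f = 2 \<and> 9 \<le> n"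
  let ?V = "split_view n 1 :: 'e view"
  \<comment> \<open>For \<open>f = 2\<close> and margin 1 the size condition reads
    \<open>10 \<le> n + 1\<close>, hence the threshold 9.\<close>
  have bounds: "1 + 2 \<le> n" "2 * f + 1 \<le> n" "2 * f + 1 \<le> (n + 1) div 2"
    using A by auto
  have "publishes n f \<theta> None 1 ?V None (Verdict_Commit (leading 1) {1..2 * f + 1})"
    by (rule publishes_split_view_verdict[OF bounds])
  moreover have "honest_majority n {1..f} ?V \<noteq> leading 1"
    using A bounds by (intro honest_majority_split_view_ne) auto
  moreover have "byzantine n f {1..f}"
    using bounds by (intro byzantine_initial) auto
  ultimately show "\<not> (\<forall>B (V :: 'e view) sel v S.
      byzantine n f B \<and> delivered_view n f V \<and>
      publishes n f \<theta> None 1 V sel (Verdict_Commit v S) \<longrightarrow> v = honest_majority n B V)"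
    using delivered_view_split_view by metis
next
  assume A: "4 * f + 2 \<le> n"
  have bounds: "0 + 2 \<le> n" "2 * f + 1 \<le> n" "2 * f + 1 \<le> (n + 0) div 2"
    using A by auto
  \<comment> \<open>An exact tie between the two large groups refutes margin 1.\<close>
  have "verdict_margin (split_view n 0 :: 'e view) = 0"
    using bounds by (simp add: verdict_margin_split_view)
  moreover obtain sel S where
    "publishes n f \<theta> None 1 (split_view n 0 :: 'e view) sel (Semantic_Commit (leading 0) S)"
    using publishes_split_view_semantic[OF bounds theta, of None] by (auto simp: gate_passes_def)
  ultimately show "\<not> (\<forall>(V :: 'e view) sel v S.
      delivered_view n f V \<and> publishes n f \<theta> None 1 V sel (Semantic_Commit v S) \<longrightarrow>
      1 \<le> verdict_margin V)"
    using delivered_view_split_view by (metis not_one_le_zero)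
qed

end
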